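(* Let $G=(V,E)$ be an undirected connected graph on $N$ vertices with graph Laplacian ${\bf L}$, and let $\Lambda\subset V$ with $|\Lambda|<N$ and $\Lambda^{\complement}=V\setminus\Lambda$. Then the cosparse analysis subspace satisfies \[N({\bf \Psi}_{\Lambda}{\bf L})=\{z{\bf 1}_N+{\bf L}^{\dagger}{\bf \Psi}_{\Lambda^{\complement}}^T{\bf W}{\bf c}\;:\;z\in\mathbb{R},\ {\bf c}\in\mathbb{R}^{|\Lambda^{\complement}|-1}\},\] i.e. it is a constrained instance of the sparse synthesis subspace $\{{\bf L}^{\dagger}{\bf \Psi}_{\Lambda^{\complement}}^T{\bf v}: {\bf v}\in\mathbb{R}^{|\Lambda^{\complement}|}\}$ (with ${\bf v}$ restricted to the range of ${\bf W}$), translated by $N({\bf L})=\{z{\bf 1}_N: z\in\mathbb{R}\}$, where the matrix ${\bf W}$ satisfies $\langle {\bf \Psi}_{\Lambda^{\complement}}^T{\bf W}{\bf e}_j,{\bf 1}_N\rangle=0$ for $j=0,\dots,|\Lambda^{\complement}|-2$.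
   Context: The graph Laplacian is ${\bf L}={\bf D}-{\bf A}$, with ${\bf A}$ the symmetric nonnegative weighted adjacency matrix and ${\bf D}$ the diagonal degree matrix; ${\bf L}^{\dagger}$ is its Moore–Penrose pseudoinverse. ${\bf 1}_N$ is the all-ones vector, ${\bf e}_j$ the canonical basis vectors. For an ordered index set $\Lambda=\{\lambda_1<\lambda_2<\dots\}\subset\{0,\dots,N-1\}$, ${\bf \Psi}_{\Lambda}\in\mathbb{R}^{|\Lambda|\times N}$ is the sampling matrix with $\Psi_{\Lambda}(i,j)=1$ if $j=\lambda_i$ and $0$ otherwise. With $n=|\Lambda^{\complement}|$, ${\bf W}\in\mathbb{R}^{n\times(n-1)}$ is the matrix (rows $i=1,\dots,n$, columns $j=1,\dots,n-1$) with $W_{jj}=n-j$, $W_{ij}=-1$ for $i>j$, and $W_{ij}=0$ for $i<j$ (so each column sums to zero). $N(\cdot)$ denotes the nullspace. *)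

theory Defs
  imports
    "Jordan_Normal_Form.Matrix_Kernel"
    "Graph_Theory.Graph_Theory"
begin

text \<open>
  Vertices, rows and columns are numbered from 0. An undirected graph is a symmetric digraph
  (locale \<^locale>\<open>pair_pseudo_graph\<close>): each edge is the pair of its two orientations. Loops are
  permitted; their weights cancel in the Laplacian.
\<close>

definition weighted_adjacency :: "nat \<Rightarrow> nat pair_pre_digraph \<Rightarrow> real mat \<Rightarrow> bool" where
  "weighted_adjacency N G A \<longleftrightarrow>
     A \<in> carrier_mat N N \<and> transpose_mat A = A \<and>
     (\<forall>i<N. \<forall>j<N. A $$ (i, j) \<ge> 0 \<and> (A $$ (i, j) > 0 \<longleftrightarrow> (i, j) \<in> parcs G))"

definition degree_mat :: "real mat \<Rightarrow> real mat" where
  "degree_mat A = mat (dim_row A) (dim_row A)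
     (\<lambda>(i, j). if i = j then (\<Sum>k<dim_col A. A $$ (i, k)) else 0)"

definition graph_laplacian :: "real mat \<Rightarrow> real mat" where
  "graph_laplacian A = degree_mat A - A"

definition is_pseudoinverse :: "real mat \<Rightarrow> real mat \<Rightarrow> bool" where
  "is_pseudoinverse A X \<longleftrightarrow>
     X \<in> carrier_mat (dim_col A) (dim_row A) \<and>
     A * X * A = A \<and>
     X * A * X = X \<and>
     transpose_mat (A * X) = A * X \<and>
     transpose_mat (X * A) = X * A"

definition pseudoinverse :: "real mat \<Rightarrow> real mat" where
  "pseudoinverse A = (THE X. is_pseudoinverse A X)"

lemma is_pseudoinverse_unique:
  assumes "is_pseudoinverse A X" "is_pseudoinverse A Y"
  shows "X = Y"
proof -
  define m n where "m = dim_row A" and "n = dim_col A"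
  have A: "A \<in> carrier_mat m n" by (simp add: m_def n_def)
  have X: "X \<in> carrier_mat n m" "A * X * A = A" "X * A * X = X"
      "transpose_mat (A * X) = A * X" "transpose_mat (X * A) = X * A"
    and Y: "Y \<in> carrier_mat n m" "A * Y * A = A" "Y * A * Y = Y"
      "transpose_mat (A * Y) = A * Y" "transpose_mat (Y * A) = Y * A"
    using assms by (auto simp: is_pseudoinverse_def m_def n_def)
  have AX: "A * X \<in> carrier_mat m m" and AY: "A * Y \<in> carrier_mat m m"
    and XA: "X * A \<in> carrier_mat n n" and YA: "Y * A \<in> carrier_mat n n"
    using A X(1) Y(1) by auto
  have 1: "(A * Y) * (A * X) = A * X"
    using assoc_mult_mat[OF AY A X(1)] Y(2) by simp
  have 2: "(A * X) * (A * Y) = A * Y"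
    using assoc_mult_mat[OF AX A Y(1)] X(2) by simp
  have "A * X = transpose_mat ((A * Y) * (A * X))" using 1 X(4) by simp
  also have "\<dots> = (A * X) * (A * Y)" using transpose_mult[OF AY AX] X(4) Y(4) by simp
  finally have eqA: "A * X = A * Y" using 2 by simp
  have 3: "(X * A) * (Y * A) = X * A"
    using assoc_mult_mat[OF X(1) A YA] assoc_mult_mat[OF A Y(1) A] Y(2) by simp
  have 4: "(Y * A) * (X * A) = Y * A"
    using assoc_mult_mat[OF Y(1) A XA] assoc_mult_mat[OF A X(1) A] X(2) by simp
  have "X * A = transpose_mat ((X * A) * (Y * A))" using 3 X(5) by simp
  also have "\<dots> = (Y * A) * (X * A)" using transpose_mult[OF XA YA] X(5) Y(5) by simp
  finally have eqB: "X * A = Y * A" using 4 by simp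
  have "X = X * A * X" using X(3) by simp
  also have "\<dots> = Y * (A * X)" using eqB assoc_mult_mat[OF Y(1) A X(1)] by simp
  also have "\<dots> = Y * A * Y" using eqA assoc_mult_mat[OF Y(1) A Y(1)] by simp
  finally show ?thesis using Y(3) by simp
qed

lemma pseudoinverse_eqI: "is_pseudoinverse A X \<Longrightarrow> pseudoinverse A = X"
  unfolding pseudoinverse_def by (blast intro: is_pseudoinverse_unique)

definition sampling_mat :: "nat \<Rightarrow> nat set \<Rightarrow> real mat" where
  "sampling_mat N \<Lambda> = mat (card \<Lambda>) N
     (\<lambda>(i, j). if j = sorted_list_of_set \<Lambda> ! i then 1 else 0)"

text \<open>Column \<open>j\<close> here is column \<open>j + 1\<close> in 1-based numbering, hence the diagonal
  entry \<open>n - (j + 1)\<close>.\<close>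

definition W_mat :: "nat \<Rightarrow> real mat" where
  "W_mat n = mat n (n - 1)
     (\<lambda>(i, j). if i = j then real n - real (j + 1) else if j < i then - 1 else 0)"

definition ones_vec :: "nat \<Rightarrow> real vec" where
  "ones_vec N = vec N (\<lambda>_. 1)"

definition mat_range :: "real mat \<Rightarrow> real vec set" where
  "mat_range M = {M *\<^sub>v c | c. c \<in> carrier_vec (dim_col M)}"

end

theory Submission
  imports Defs "Jordan_Normal_Form.Determinant"
begin

text \<open>Connectedness makes the kernel of \<open>L\<close> the constant vectors, so both products of
  \<open>L\<close> with its pseudoinverse are the projection onto the vectors of sum zero. A signal \<open>x\<close> is
  cosparse iff \<open>L x\<close> is supported on the complement of \<open>\<Lambda>\<close>; as \<open>L x\<close> has sum zero, its values
  there form a vector in the range of \<open>W\<close>, and applying the pseudoinverse recovers \<open>x\<close> up to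
  a constant. Conversely, \<open>L\<close> undoes its pseudoinverse on vectors of sum zero.\<close>

section \<open>Graph Laplacians\<close>

lemma ones_vec_carrier [simp]: "ones_vec N \<in> carrier_vec N"
  by (simp add: ones_vec_def)

lemma scalar_prod_ones_vec: "x \<bullet> ones_vec N = (\<Sum>i<N. x $ i)"
  by (simp add: ones_vec_def scalar_prod_def atLeast0LessThan)

lemma weighted_adjacency_sym:
  assumes "weighted_adjacency N G A" "i < N" "j < N"
  shows "A $$ (i, j) = A $$ (j, i)"
proof -
  have "A \<in> carrier_mat N N" "transpose_mat A = A"
    using assms by (auto simp: weighted_adjacency_def)
  then show ?thesis using assms(2,3) by (metis carrier_matD index_transpose_mat(1))
qed

lemma graph_laplacian_carrier:
  assumes "weighted_adjacency N G A"
  shows "graph_laplacian A \<in> carrier_mat N N"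
  using assms by (auto simp: weighted_adjacency_def graph_laplacian_def degree_mat_def)

lemma transpose_graph_laplacian:
  assumes "weighted_adjacency N G A"
  shows "transpose_mat (graph_laplacian A) = graph_laplacian A"
proof (rule eq_matI)
  have A: "A \<in> carrier_mat N N" using assms by (simp add: weighted_adjacency_def)
  fix i j assume "i < dim_row (graph_laplacian A)" "j < dim_col (graph_laplacian A)"
  then have ij: "i < N" "j < N" using graph_laplacian_carrier[OF assms] by auto
  show "transpose_mat (graph_laplacian A) $$ (i, j) = graph_laplacian A $$ (i, j)"
    using A ij weighted_adjacency_sym[OF assms ij]
    by (auto simp: graph_laplacian_def degree_mat_def)
qed (use graph_laplacian_carrier[OF assms] in auto)

text \<open>The degree \<open>D_ii\<close> is the \<open>i\<close>-th row sum of \<open>A\<close>,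
  so \<open>D x - A x\<close> collects into weighted differences. In this form loops and constant
  vectors visibly contribute nothing.\<close>

lemma graph_laplacian_mult_vec:
  assumes "A \<in> carrier_mat N N" "x \<in> carrier_vec N" "i < N"
  shows "(graph_laplacian A *\<^sub>v x) $ i = (\<Sum>j<N. A $$ (i, j) * (x $ i - x $ j))"
proof -
  have "(graph_laplacian A *\<^sub>v x) $ i =
      (\<Sum>j<N. ((if i = j then \<Sum>k<N. A $$ (i, k) else 0) - A $$ (i, j)) * x $ j)"
    using assms
    by (auto simp: graph_laplacian_def degree_mat_def scalar_prod_def atLeast0LessThan
        intro!: sum.cong)
  also have "\<dots> = (\<Sum>j<N. if i = j then (\<Sum>k<N. A $$ (i, k)) * x $ j else 0)
      - (\<Sum>j<N. A $$ (i, j) * x $ j)"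
    by (subst sum_subtractf [symmetric]) (auto simp: left_diff_distrib intro!: sum.cong)
  also have "\<dots> = (\<Sum>j<N. A $$ (i, j) * (x $ i - x $ j))"
    using assms(3) by (simp add: right_diff_distrib sum_subtractf sum_distrib_right)
  finally show ?thesis .
qed

text \<open>The Dirichlet energy of \<open>x\<close>. The factor 2 arises because the sum runs over
  ordered pairs and so meets each edge between distinct vertices in both orientations.\<close>

lemma graph_laplacian_quadratic_form:
  assumes "weighted_adjacency N G A" "x \<in> carrier_vec N"
  shows "(\<Sum>i<N. \<Sum>j<N. A $$ (i, j) * (x $ i - x $ j)\<^sup>2) =
      2 * (\<Sum>i<N. x $ i * (graph_laplacian A *\<^sub>v x) $ i)"
proof -
  have A: "A \<in> carrier_mat N N" using assms by (simp add: weighted_adjacency_def)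
  define S where "S = (\<Sum>i<N. \<Sum>j<N. x $ i * (A $$ (i, j) * (x $ i - x $ j)))"
  have "S = (\<Sum>i<N. \<Sum>j<N. x $ j * (A $$ (j, i) * (x $ j - x $ i)))"
    unfolding S_def by (rule sum.swap)
  also have "\<dots> = (\<Sum>i<N. \<Sum>j<N. x $ j * (A $$ (i, j) * (x $ j - x $ i)))"
    by (intro sum.cong refl) (use weighted_adjacency_sym[OF assms(1)] in auto)
  \<comment> \<open>\<open>S\<close> is added to its copy with \<open>i\<close> and \<open>j\<close>
    exchanged. The two summands \<open>x_i a (x_i - x_j)\<close> and
    \<open>x_j a (x_j - x_i)\<close> combine to \<open>a (x_i - x_j)^2\<close>.\<close>
  finally have "2 * S = S + (\<Sum>i<N. \<Sum>j<N. x $ j * (A $$ (i, j) * (x $ j - x $ i)))"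
    by simp
  also have "\<dots> = (\<Sum>i<N. \<Sum>j<N. A $$ (i, j) * (x $ i - x $ j)\<^sup>2)"
    unfolding S_def sum.distrib [symmetric]
    by (intro sum.cong refl) (simp add: power2_eq_square algebra_simps)
  finally have "(\<Sum>i<N. \<Sum>j<N. A $$ (i, j) * (x $ i - x $ j)\<^sup>2) = 2 * S" by simp
  also have "S = (\<Sum>i<N. x $ i * (graph_laplacian A *\<^sub>v x) $ i)"
    unfolding S_def using graph_laplacian_mult_vec[OF A assms(2)]
    by (auto simp: sum_distrib_left intro!: sum.cong)
  finally show ?thesis .
qed

text \<open>A kernel vector has Dirichlet energy zero, a sum of nonnegative terms, so every term
  vanishes. Positive weights then force equal values at the ends of each edge, and connectedness
  spreads this equality to all vertices.\<close>

lemma mat_kernel_graph_laplacian: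
  assumes "pair_pseudo_graph G" "Digraph_Component.connected (with_proj G)"
    and V: "pverts G = {0..<N}" and adj: "weighted_adjacency N G A"
  shows "mat_kernel (graph_laplacian A) = {z \<cdot>\<^sub>v ones_vec N | z. True}"
proof (intro equalityI subsetI)
  have A: "A \<in> carrier_mat N N" using adj by (simp add: weighted_adjacency_def)
  note L = graph_laplacian_carrier[OF adj]
  {
    fix x assume "x \<in> mat_kernel (graph_laplacian A)"
    then have x: "x \<in> carrier_vec N" and Lx: "graph_laplacian A *\<^sub>v x = 0\<^sub>v N"
      using mat_kernelD[OF L] by auto
    have nonneg: "0 \<le> A $$ (i, j) * (x $ i - x $ j)\<^sup>2" if "i < N" "j < N" for i j
      using adj that by (auto simp: weighted_adjacency_def)
    have "(\<Sum>i<N. \<Sum>j<N. A $$ (i, j) * (x $ i - x $ j)\<^sup>2) = 0"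
      using graph_laplacian_quadratic_form[OF adj x] Lx by simp
    then have row0: "\<forall>i\<in>{..<N}. (\<Sum>j<N. A $$ (i, j) * (x $ i - x $ j)\<^sup>2) = 0"
      by (subst (asm) sum_nonneg_eq_0_iff) (auto intro!: sum_nonneg nonneg)
    have term0: "A $$ (i, j) * (x $ i - x $ j)\<^sup>2 = 0" if "i < N" "j < N" for i j
    proof -
      have "(\<Sum>j<N. A $$ (i, j) * (x $ i - x $ j)\<^sup>2) = 0" using row0 that by blast
      then show ?thesis using that by (subst (asm) sum_nonneg_eq_0_iff) (auto intro: nonneg)
    qed
    interpret pair_pseudo_graph G by fact
    have edge: "x $ u = x $ v" if "(u, v) \<in> parcs G" for u v
    proof -
      have uv: "u < N" "v < N" using that in_arcsD1[OF that] in_arcsD2[OF that] V by auto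
      then have "A $$ (u, v) > 0" using adj that by (auto simp: weighted_adjacency_def)
      then show ?thesis using term0[OF uv] by simp
    qed
    \<comment> \<open>Connectedness means strong connectedness of the symmetric closure. A walk
      there may use an arc of \<open>G\<close> in either direction, which does no harm because
      \<open>edge\<close> gives an equality.\<close>
    have reach: "x $ u = x $ v" if "u < N" "v < N" for u v
    proof -
      have "strongly_connected (with_proj (mk_symmetric (with_proj G)))"
        using assms(2) by (simp add: Digraph_Component.connected_def)
      moreover have "u \<in> verts (with_proj (mk_symmetric (with_proj G)))"
        "v \<in> verts (with_proj (mk_symmetric (with_proj G)))"
        using that V by (auto simp: mk_symmetric_def)
      ultimately have "u \<rightarrow>\<^sup>*\<^bsub>with_proj (mk_symmetric (with_proj G))\<^esub> v"
        unfolding strongly_connected_def by blast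
      then have "(u, v) \<in> (parcs (mk_symmetric (with_proj G)))\<^sup>*"
        unfolding reachable_def with_proj_simps by (rule rtrancl_on_rtranclI)
      then show ?thesis
      proof (induct rule: rtrancl_induct)
        case (step y w)
        then have "(y, w) \<in> parcs G \<or> (w, y) \<in> parcs G"
          by (auto simp: mk_symmetric_def)
        then show ?case using edge step(3) by metis
      qed simp
    qed
    have "x = (x $ 0) \<cdot>\<^sub>v ones_vec N"
    proof (rule eq_vecI)
      fix i assume "i < dim_vec ((x $ 0) \<cdot>\<^sub>v ones_vec N)"
      then have "i < N" by (simp add: ones_vec_def)
      then have "x $ i = x $ 0" by (intro reach) auto
      then show "x $ i = ((x $ 0) \<cdot>\<^sub>v ones_vec N) $ i"
        using \<open>i < N\<close> by (simp add: ones_vec_def)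
    qed (use x in \<open>simp add: ones_vec_def\<close>)
    then show "x \<in> {z \<cdot>\<^sub>v ones_vec N | z. True}" by blast
  }
  fix x assume "x \<in> {z \<cdot>\<^sub>v ones_vec N | z. True}"
  then obtain z where x: "x = z \<cdot>\<^sub>v ones_vec N" by blast
  have "graph_laplacian A *\<^sub>v x = 0\<^sub>v N"
  proof (rule eq_vecI)
    fix i assume "i < dim_vec (0\<^sub>v N :: real vec)"
    then show "(graph_laplacian A *\<^sub>v x) $ i = 0\<^sub>v N $ i"
      using graph_laplacian_mult_vec[OF A, of x i] by (simp add: x ones_vec_def)
  qed (use L in auto)
  then show "x \<in> mat_kernel (graph_laplacian A)"
    using L by (intro mat_kernelI) (auto simp: x)
qed

section \<open>The pseudoinverse\<close>

text \<open>This is \<open>1 1^T / N\<close>, which replaces every entry of a vector by the mean of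
  its entries.\<close>

definition mean_mat :: "nat \<Rightarrow> real mat" where
  "mean_mat N = mat N N (\<lambda>_. 1 / real N)"

lemma mean_mat_carrier [simp]: "mean_mat N \<in> carrier_mat N N"
  by (simp add: mean_mat_def)

lemma mean_mat_dim [simp]: "dim_row (mean_mat N) = N" "dim_col (mean_mat N) = N"
  by (simp_all add: mean_mat_def)

lemma transpose_mean_mat [simp]: "transpose_mat (mean_mat N) = mean_mat N"
  by (rule eq_matI) (auto simp: mean_mat_def)

lemma mean_mat_mult_vec:
  assumes "x \<in> carrier_vec N"
  shows "mean_mat N *\<^sub>v x = (x \<bullet> ones_vec N / real N) \<cdot>\<^sub>v ones_vec N"
  using assms
  by (intro eq_vecI) (auto simp: mean_mat_def ones_vec_def scalar_prod_def sum_divide_distrib)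

lemma mean_mat_idem:
  assumes "N > 0"
  shows "mean_mat N * mean_mat N = mean_mat N"
  using assms by (intro eq_matI) (auto simp: mean_mat_def scalar_prod_def)

lemma mult_mean_mat_eq_0:
  assumes L: "L \<in> carrier_mat N N" and "L *\<^sub>v ones_vec N = 0\<^sub>v N"
  shows "L * mean_mat N = 0\<^sub>m N N"
proof (rule eq_matI)
  fix i j assume "i < dim_row (0\<^sub>m N N :: real mat)" "j < dim_col (0\<^sub>m N N :: real mat)"
  then have ij: "i < N" "j < N" by auto
  have "(L * mean_mat N) $$ (i, j) = (L *\<^sub>v ones_vec N) $ i / real N"
    using ij L by (simp add: mean_mat_def ones_vec_def scalar_prod_def sum_divide_distrib)
  then show "(L * mean_mat N) $$ (i, j) = 0\<^sub>m N N $$ (i, j)" using assms ij by simp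
qed (use L in \<open>auto simp: mean_mat_def\<close>)

text \<open>The pseudoinverse is \<open>(L + J)\<^sup>-\<^sup>1 - J\<close>, where \<open>J\<close> is the
  orthogonal projection onto the constant vectors.\<close>

lemma pseudoinverse_kernel_ones:
  assumes L: "L \<in> carrier_mat N N" and sym: "transpose_mat L = L"
    and ker: "mat_kernel L = {z \<cdot>\<^sub>v ones_vec N | z. True}" and N: "N > 0"
  shows "pseudoinverse L \<in> carrier_mat N N"
    and "L * pseudoinverse L = 1\<^sub>m N - mean_mat N"
    and "pseudoinverse L * L = 1\<^sub>m N - mean_mat N"
proof -
  let ?J = "mean_mat N"
  note J = mean_mat_carrier[of N] and JJ = mean_mat_idem[OF N]
  have "1 \<cdot>\<^sub>v ones_vec N \<in> mat_kernel L" unfolding ker by blast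
  then have L1: "L *\<^sub>v ones_vec N = 0\<^sub>v N" using mat_kernelD(2)[OF L] by simp
  have LJ: "L * ?J = 0\<^sub>m N N" by (rule mult_mean_mat_eq_0[OF L L1])
  \<comment> \<open>Obtained by transposing \<open>LJ\<close>, as both factors are
    symmetric.\<close>
  have JL: "?J * L = 0\<^sub>m N N"
    using arg_cong[OF LJ, of transpose_mat] transpose_mult[OF L J] sym by simp
  \<comment> \<open>\<open>L\<close> degenerates exactly on the constant vectors, where
    \<open>?J\<close> is the identity, so adding \<open>?J\<close> makes the matrix invertible
    without mixing the two subspaces.\<close>
  define M where "M = L + ?J"
  have M: "M \<in> carrier_mat N N" using L by (simp add: M_def)
  have MJ: "M * ?J = ?J"
    unfolding M_def using add_mult_distrib_mat[OF L J J] LJ JJ by simp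
  have JM: "?J * M = ?J"
    unfolding M_def using mult_add_distrib_mat[OF J L J] JL JJ by simp
  \<comment> \<open>Multiplying \<open>M v = 0\<close> by \<open>?J\<close> removes the part from
    \<open>L\<close> and leaves \<open>?J v = 0\<close>. Hence also \<open>L v = 0\<close>, so
    \<open>v\<close> is constant, and its mean is zero.\<close>
  have "v = 0\<^sub>v N" if v: "v \<in> carrier_vec N" and Mv: "M *\<^sub>v v = 0\<^sub>v N" for v
  proof -
    have "?J *\<^sub>v v = ?J *\<^sub>v (M *\<^sub>v v)"
      using assoc_mult_mat_vec[OF J M v] JM by simp
    then have Jv: "?J *\<^sub>v v = 0\<^sub>v N"
      unfolding Mv by (auto simp: mean_mat_def)
    then have "L *\<^sub>v v = 0\<^sub>v N"
      using Mv L v add_mult_distrib_mat_vec[OF L J v] by (simp add: M_def)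
    then obtain z where z: "v = z \<cdot>\<^sub>v ones_vec N"
      using ker mat_kernelI[OF L v] by auto
    have "z = (?J *\<^sub>v v) $ 0"
      unfolding mean_mat_mult_vec[OF v] using N by (simp add: z ones_vec_def scalar_prod_def)
    then have "z = 0" unfolding Jv using N by simp
    then show ?thesis unfolding z by (intro eq_vecI) (auto simp: ones_vec_def)
  qed
  then have "det M \<noteq> 0" using det_0_iff_vec_prod_zero[OF M] by blast
  then have "M \<in> Units (ring_mat TYPE(real) N ())" by (rule det_non_zero_imp_unit[OF M])
  then obtain K where K: "K \<in> carrier_mat N N" and KM: "K * M = 1\<^sub>m N" and MK: "M * K = 1\<^sub>m N"
    by (auto simp: Units_def ring_mat_def)
  \<comment> \<open>\<open>M\<close> fixes the constant vectors, so its inverse does too. This makes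
    \<open>K - ?J\<close> vanish on them.\<close>
  have KJ: "K * ?J = ?J"
    using assoc_mult_mat[OF K M J] MJ KM left_mult_one_mat[OF J] by simp
  have JK: "?J * K = ?J"
    using assoc_mult_mat[OF J M K] JM MK right_mult_one_mat[OF J] by simp
  have L_eq: "L = M - ?J"
    using L by (intro eq_matI) (auto simp: M_def)
  define X where "X = K - ?J"
  have X: "X \<in> carrier_mat N N" unfolding X_def by (rule minus_carrier_mat[OF J])
  have LX: "L * X = 1\<^sub>m N - ?J"
  proof -
    have "L * X = L * K - L * ?J" unfolding X_def by (rule mult_minus_distrib_mat[OF L K J])
    also have "L * K = M * K - ?J * K" unfolding L_eq by (rule minus_mult_distrib_mat[OF M J K])
    finally show ?thesis using LJ MK JK by (auto intro!: eq_matI)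
  qed
  have XL: "X * L = 1\<^sub>m N - ?J"
  proof -
    have "X * L = K * L - ?J * L" unfolding X_def by (rule minus_mult_distrib_mat[OF K J L])
    also have "K * L = K * M - K * ?J" unfolding L_eq by (rule mult_minus_distrib_mat[OF K M J])
    finally show ?thesis using JL KM KJ by (auto intro!: eq_matI)
  qed
  have JX: "?J * X = 0\<^sub>m N N"
    unfolding X_def using mult_minus_distrib_mat[OF J K J] JK JJ by simp
  have sym': "transpose_mat (1\<^sub>m N - ?J) = 1\<^sub>m N - ?J"
    by (rule eq_matI) (auto simp: mean_mat_def)
  \<comment> \<open>Both products of \<open>L\<close> and \<open>X\<close> are the symmetric matrix
    \<open>1 - ?J\<close>, which settles the two symmetry conditions. The other two Penrose
    equations reduce to \<open>?J * L = 0\<close> and \<open>?J * X = 0\<close>.\<close>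
  have "L * X * L = L"
    unfolding LX using minus_mult_distrib_mat[OF one_carrier_mat J L] JL L by (auto intro!: eq_matI)
  moreover have "X * L * X = X"
    unfolding XL using minus_mult_distrib_mat[OF one_carrier_mat J X] JX X by (auto intro!: eq_matI)
  ultimately have "is_pseudoinverse L X"
    unfolding is_pseudoinverse_def LX XL using L X sym' by auto
  then have "pseudoinverse L = X" by (rule pseudoinverse_eqI)
  then show "pseudoinverse L \<in> carrier_mat N N"
    and "L * pseudoinverse L = 1\<^sub>m N - ?J"
    and "pseudoinverse L * L = 1\<^sub>m N - ?J"
    using X LX XL by auto
qed

text \<open>Centring: the mean is subtracted from every entry, so a vector of sum zero is left
  unchanged.\<close>

lemma one_minus_mean_mat_mult_vec:
  assumes "x \<in> carrier_vec N"
  shows "(1\<^sub>m N - mean_mat N) *\<^sub>v x = x - (x \<bullet> ones_vec N / real N) \<cdot>\<^sub>v ones_vec N"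
  using minus_mult_distrib_mat_vec[OF one_carrier_mat mean_mat_carrier assms]
    mean_mat_mult_vec[OF assms] assms by simp

section \<open>Sampling matrices\<close>

lemma sampling_mat_carrier [simp]: "sampling_mat N S \<in> carrier_mat (card S) N"
  by (simp add: sampling_mat_def)

lemma transpose_sampling_mat_carrier [simp]:
  "transpose_mat (sampling_mat N S) \<in> carrier_mat N (card S)"
  by simp

context
  fixes N :: nat and S :: "nat set"
  assumes S: "S \<subseteq> {0..<N}"
begin

lemma finite_sampled: "finite S"
  using S finite_subset by blast

lemma sampled_nth_mem:
  assumes "i < card S"
  shows "sorted_list_of_set S ! i \<in> S"
  using assms nth_mem[of i "sorted_list_of_set S"] finite_sampled by simp

lemma sampled_nthE:
  assumes "s \<in> S"
  obtains i where "i < card S" "sorted_list_of_set S ! i = s"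
proof -
  have "s \<in> set (sorted_list_of_set S)" using assms finite_sampled by simp
  then show ?thesis using that by (auto simp: in_set_conv_nth)
qed

lemma sampled_nth_eq_iff:
  assumes "i < card S" "k < card S"
  shows "sorted_list_of_set S ! i = sorted_list_of_set S ! k \<longleftrightarrow> i = k"
  using assms nth_eq_iff_index_eq[OF distinct_sorted_list_of_set, of i S k] by simp

lemma sampling_mat_mult_vec:
  assumes "x \<in> carrier_vec N" "i < card S"
  shows "(sampling_mat N S *\<^sub>v x) $ i = x $ (sorted_list_of_set S ! i)"
proof -
  have "(sampling_mat N S *\<^sub>v x) $ i =
      (\<Sum>j<N. (if j = sorted_list_of_set S ! i then 1 else 0) * x $ j)"
    using assms by (simp add: sampling_mat_def scalar_prod_def atLeast0LessThan)
  also have "\<dots> = (\<Sum>j<N. if j = sorted_list_of_set S ! i then x $ j else 0)"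
    by (rule sum.cong) auto
  finally have "(sampling_mat N S *\<^sub>v x) $ i =
      (\<Sum>j<N. if j = sorted_list_of_set S ! i then x $ j else 0)" .
  moreover have "sorted_list_of_set S ! i < N" using sampled_nth_mem[OF assms(2)] S by auto
  ultimately show ?thesis by simp
qed

lemma sampling_mat_mult_vec_eq_0_iff:
  assumes "x \<in> carrier_vec N"
  shows "sampling_mat N S *\<^sub>v x = 0\<^sub>v (card S) \<longleftrightarrow> (\<forall>s\<in>S. x $ s = 0)"
proof
  assume *: "sampling_mat N S *\<^sub>v x = 0\<^sub>v (card S)"
  show "\<forall>s\<in>S. x $ s = 0"
  proof
    fix s assume "s \<in> S"
    then obtain i where "i < card S" "sorted_list_of_set S ! i = s" by (rule sampled_nthE)
    then show "x $ s = 0" using sampling_mat_mult_vec[OF assms, of i] * by simp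
  qed
next
  assume *: "\<forall>s\<in>S. x $ s = 0"
  show "sampling_mat N S *\<^sub>v x = 0\<^sub>v (card S)"
    by (rule eq_vecI)
      (use * sampling_mat_mult_vec[OF assms] sampled_nth_mem in \<open>auto simp: sampling_mat_def\<close>)
qed

text \<open>Kept as a sum because \<open>j\<close> need not be sampled: at most one summand
  survives, and none if \<open>j\<close> lies outside \<open>S\<close>.\<close>

lemma transpose_sampling_mat_mult_vec:
  assumes "v \<in> carrier_vec (card S)" "j < N"
  shows "(transpose_mat (sampling_mat N S) *\<^sub>v v) $ j =
      (\<Sum>i<card S. if j = sorted_list_of_set S ! i then v $ i else 0)"
  using assms
  by (auto simp: sampling_mat_def scalar_prod_def atLeast0LessThan intro!: sum.cong)

lemma transpose_sampling_mat_mult_vec_notin: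
  assumes "v \<in> carrier_vec (card S)" "j < N" "j \<notin> S"
  shows "(transpose_mat (sampling_mat N S) *\<^sub>v v) $ j = 0"
  unfolding transpose_sampling_mat_mult_vec[OF assms(1,2)]
proof (rule sum.neutral, rule ballI)
  fix i assume "i \<in> {..<card S}"
  then have "j \<noteq> sorted_list_of_set S ! i" using sampled_nth_mem[of i] assms(3) by auto
  then show "(if j = sorted_list_of_set S ! i then v $ i else 0) = 0" by simp
qed

text \<open>Sampling followed by zero-padding is the coordinate projection onto \<open>S\<close>, so
  it fixes vectors supported there.\<close>

lemma transpose_sampling_mat_sampling_mat:
  assumes x: "x \<in> carrier_vec N" and supp: "\<And>j. j < N \<Longrightarrow> j \<notin> S \<Longrightarrow> x $ j = 0"
  shows "transpose_mat (sampling_mat N S) *\<^sub>v (sampling_mat N S *\<^sub>v x) = x"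
proof (rule eq_vecI)
  let ?v = "sampling_mat N S *\<^sub>v x"
  have v: "?v \<in> carrier_vec (card S)"
    by (rule mult_mat_vec_carrier[OF sampling_mat_carrier x])
  fix j assume "j < dim_vec x"
  then have j: "j < N" using x by simp
  show "(transpose_mat (sampling_mat N S) *\<^sub>v ?v) $ j = x $ j"
  proof (cases "j \<in> S")
    case True
    then obtain k where k: "k < card S" "sorted_list_of_set S ! k = j" by (rule sampled_nthE)
    \<comment> \<open>The list of sampled indices is distinct, so \<open>k\<close> is the only
      position at which \<open>j\<close> occurs.\<close>
    have "(transpose_mat (sampling_mat N S) *\<^sub>v ?v) $ j = (\<Sum>i<card S. if i = k then ?v $ i else 0)"
      unfolding transpose_sampling_mat_mult_vec[OF v j]
    proof (rule sum.cong)
      fix i assume "i \<in> {..<card S}"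
      then have "j = sorted_list_of_set S ! i \<longleftrightarrow> i = k"
        using sampled_nth_eq_iff[of i k] k by auto
      then show "(if j = sorted_list_of_set S ! i then ?v $ i else 0) = (if i = k then ?v $ i else 0)"
        by simp
    qed simp
    also have "\<dots> = ?v $ k" using k(1) by simp
    finally show ?thesis using sampling_mat_mult_vec[OF x k(1)] k(2) by simp
  next
    case False
    then show ?thesis using transpose_sampling_mat_mult_vec_notin[OF v j] supp[OF j] by simp
  qed
qed (use x in \<open>auto simp: sampling_mat_def\<close>)

text \<open>By adjointness the matrix moves to the other side, and sampling an all-ones vector gives
  a shorter all-ones vector.\<close>

lemma transpose_sampling_mat_scalar_ones:
  assumes "v \<in> carrier_vec (card S)"
  shows "(transpose_mat (sampling_mat N S) *\<^sub>v v) \<bullet> ones_vec N = v \<bullet> ones_vec (card S)"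
proof -
  have "sampling_mat N S *\<^sub>v ones_vec N = ones_vec (card S)"
  proof (rule eq_vecI)
    fix i assume "i < dim_vec (ones_vec (card S))"
    then have i: "i < card S" by (simp add: ones_vec_def)
    have "sorted_list_of_set S ! i < N" using sampled_nth_mem[OF i] S by auto
    then show "(sampling_mat N S *\<^sub>v ones_vec N) $ i = ones_vec (card S) $ i"
      using sampling_mat_mult_vec[OF ones_vec_carrier i] i by (simp add: ones_vec_def)
  qed (simp add: sampling_mat_def ones_vec_def)
  then show ?thesis
    using transpose_vec_mult_scalar[OF sampling_mat_carrier ones_vec_carrier assms]
    by simp
qed

end

section \<open>The range of the matrix W\<close>

lemma W_mat_carrier [simp]: "W_mat n \<in> carrier_mat n (n - 1)"
  by (simp add: W_mat_def)

text \<open>The last row, \<open>i = n - 1\<close>, has no diagonal entry because \<open>W\<close>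
  has one column fewer than rows; this is the reason for the case distinction.\<close>

lemma W_mat_mult_vec:
  assumes "c \<in> carrier_vec (n - 1)" "i < n"
  shows "(W_mat n *\<^sub>v c) $ i =
      (if i < n - 1 then (real n - real (i + 1)) * c $ i else 0) - (\<Sum>j<i. c $ j)"
proof -
  have "(W_mat n *\<^sub>v c) $ i =
      (\<Sum>j<n-1. (if i = j then (real n - real (j + 1)) * c $ j else 0) - (if j < i then c $ j else 0))"
    using assms
    by (auto simp: W_mat_def scalar_prod_def atLeast0LessThan intro!: sum.cong)
  also have "\<dots> = (\<Sum>j<n-1. if i = j then (real n - real (j + 1)) * c $ j else 0)
      - (\<Sum>j<n-1. if j < i then c $ j else 0)"
    by (rule sum_subtractf)
  also have "(\<Sum>j<n-1. if j < i then c $ j else 0) = (\<Sum>j<i. c $ j)"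
    by (rule sum.mono_neutral_cong_right) (use assms(2) in auto)
  finally show ?thesis by simp
qed

text \<open>By adjointness it is enough that every column of \<open>W\<close> sums to zero: column
  \<open>j\<close> has \<open>n - (j + 1)\<close> on the diagonal and exactly that many entries
  \<open>-1\<close> below it.\<close>

lemma W_mat_scalar_ones:
  assumes "c \<in> carrier_vec (n - 1)"
  shows "(W_mat n *\<^sub>v c) \<bullet> ones_vec n = 0"
proof -
  have "transpose_mat (W_mat n) *\<^sub>v ones_vec n = 0\<^sub>v (n - 1)"
  proof (rule eq_vecI)
    fix j assume "j < dim_vec (0\<^sub>v (n - 1) :: real vec)"
    then have j: "j < n - 1" by simp
    have "(transpose_mat (W_mat n) *\<^sub>v ones_vec n) $ j =
        (\<Sum>i<n. (if i = j then real n - real (j + 1) else 0) - (if j < i then 1 else 0))"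
      using j
      by (auto simp: W_mat_def ones_vec_def scalar_prod_def atLeast0LessThan intro!: sum.cong)
    also have "\<dots> = (real n - real (j + 1)) - (\<Sum>i<n. if j < i then 1 else 0)"
      using j by (simp add: sum_subtractf)
    also have "(\<Sum>i<n. if j < i then 1 else 0 :: real) = (\<Sum>i\<in>{j<..<n}. 1)"
      by (rule sum.mono_neutral_cong_right) auto
    also have "\<dots> = real n - real (j + 1)" using j by (simp add: of_nat_diff)
    finally show "(transpose_mat (W_mat n) *\<^sub>v ones_vec n) $ j = 0\<^sub>v (n - 1) $ j"
      using j by simp
  qed (simp add: W_mat_def)
  moreover have "transpose_mat (W_mat n) \<in> carrier_mat (n - 1) n"
    by (simp only: transpose_carrier_mat W_mat_carrier)
  ultimately have "(W_mat n *\<^sub>v c) \<bullet> ones_vec n = c \<bullet> 0\<^sub>v (n - 1)"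
    using transpose_vec_mult_scalar[OF _ ones_vec_carrier assms] by (metis transpose_transpose)
  then show ?thesis using assms by simp
qed

text \<open>\<open>W\<close> without its last row is lower triangular with nonzero diagonal, so forward
  substitution applies.\<close>

lemma W_mat_forward_substitution:
  assumes "m \<le> n - 1"
  shows "\<exists>c :: nat \<Rightarrow> real. \<forall>i<m. (real n - real (i + 1)) * c i - (\<Sum>j<i. c j) = f i"
  using assms
proof (induction m)
  case (Suc m)
  then obtain c where c: "\<forall>i<m. (real n - real (i + 1)) * c i - (\<Sum>j<i. c j) = f i" by auto
  \<comment> \<open>The new value solves equation \<open>m\<close>; its pivot is nonzero since
    \<open>m + 1 < n\<close>. Earlier equations involve only indices below \<open>m\<close> and stay
    valid.\<close>
  define c' where "c' = c(m := (f m + (\<Sum>j<m. c j)) / (real n - real (m + 1)))"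
  have sum_c': "(\<Sum>j<i. c' j) = (\<Sum>j<i. c j)" if "i \<le> m" for i
    by (rule sum.cong) (use that in \<open>auto simp: c'_def\<close>)
  have "real n - real (m + 1) \<noteq> 0" using Suc.prems by auto
  then have "(real n - real (i + 1)) * c' i - (\<Sum>j<i. c' j) = f i" if "i < Suc m" for i
    using that c sum_c'[of i] by (cases "i = m") (auto simp: c'_def)
  then show ?case by blast
qed simp

text \<open>One inclusion is the vanishing of the column sums. For the other, forward substitution
  solves the first \<open>n - 1\<close> equations, and the last one then holds because both sides
  have sum zero.\<close>

lemma mat_range_W_mat:
  "mat_range (W_mat n) = {v \<in> carrier_vec n. v \<bullet> ones_vec n = 0}"
proof (intro equalityI subsetI)
  fix v assume "v \<in> mat_range (W_mat n)"
  then obtain c where "v = W_mat n *\<^sub>v c" "c \<in> carrier_vec (n - 1)"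
    unfolding mat_range_def carrier_matD[OF W_mat_carrier] by blast
  then show "v \<in> {v \<in> carrier_vec n. v \<bullet> ones_vec n = 0}"
    using W_mat_scalar_ones mult_mat_vec_carrier[OF W_mat_carrier] by blast
next
  fix v :: "real vec" assume "v \<in> {v \<in> carrier_vec n. v \<bullet> ones_vec n = 0}"
  then have v: "v \<in> carrier_vec n" and v0: "(\<Sum>i<n. v $ i) = 0"
    by (auto simp: scalar_prod_ones_vec)
  obtain c where c: "\<forall>i<n-1. (real n - real (i + 1)) * c i - (\<Sum>j<i. c j) = v $ i"
    using W_mat_forward_substitution by blast
  let ?w = "W_mat n *\<^sub>v vec (n - 1) c"
  have w: "?w \<in> carrier_vec n" by (rule mult_mat_vec_carrier[OF W_mat_carrier]) simp
  have eq: "?w $ i = v $ i" if "i < n - 1" for i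
  proof -
    have "(\<Sum>j<i. vec (n - 1) c $ j) = (\<Sum>j<i. c j)" by (rule sum.cong) (use that in auto)
    then show ?thesis using that c W_mat_mult_vec[of "vec (n - 1) c" n i] by simp
  qed
  have last: "?w $ (n - 1) = v $ (n - 1)" if "n > 0"
  proof -
    have "(\<Sum>i<n. ?w $ i) = (\<Sum>i<n. v $ i)"
      using W_mat_scalar_ones[of "vec (n - 1) c" n] v0 by (simp add: scalar_prod_ones_vec)
    moreover have "{..<n} = insert (n - 1) {..<n-1}" using that by auto
    ultimately show ?thesis using eq by simp
  qed
  have "?w = v"
  proof (rule eq_vecI)
    fix i assume "i < dim_vec v"
    then have "i < n" using v by simp
    then show "?w $ i = v $ i" using eq last by (cases "i = n - 1") auto
  qed (use v carrier_matD[OF W_mat_carrier] in auto)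
  then show "v \<in> mat_range (W_mat n)"
    unfolding mat_range_def by (auto simp: W_mat_def intro!: exI[of _ "vec (n - 1) c"])
qed

section \<open>The cosparse analysis subspace\<close>

text \<open>The graph has disappeared: all that remains of it is that \<open>L\<close> is symmetric
  and its kernel consists of the constant vectors.\<close>

lemma mat_kernel_sampling_laplacian:
  assumes L: "L \<in> carrier_mat N N" and sym: "transpose_mat L = L"
    and ker: "mat_kernel L = {z \<cdot>\<^sub>v ones_vec N | z. True}" and N: "N > 0"
    and S: "S \<subseteq> {0..<N}" and T: "T = {0..<N} - S"
  shows "mat_kernel (sampling_mat N S * L) =
      {u + (pseudoinverse L * transpose_mat (sampling_mat N T)) *\<^sub>v v
        | u v. u \<in> mat_kernel L \<and> v \<in> mat_range (W_mat (card T))}"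
proof (intro equalityI subsetI)
  let ?P = "pseudoinverse L" and ?T = "transpose_mat (sampling_mat N T)"
  note P = pseudoinverse_kernel_ones[OF L sym ker N]
  have TN: "T \<subseteq> {0..<N}" using T by auto
  have SL: "sampling_mat N S * L \<in> carrier_mat (card S) N"
    using L by (rule mult_carrier_mat[OF sampling_mat_carrier])
  have "1 \<cdot>\<^sub>v ones_vec N \<in> mat_kernel L" unfolding ker by blast
  then have L1: "L *\<^sub>v ones_vec N = 0\<^sub>v N" using mat_kernelD(2)[OF L] by simp
  {
    fix x assume "x \<in> mat_kernel (sampling_mat N S * L)"
    then have x: "x \<in> carrier_vec N" and "(sampling_mat N S * L) *\<^sub>v x = 0\<^sub>v (card S)"
      using mat_kernelD[OF SL] by auto
    moreover have Lx: "L *\<^sub>v x \<in> carrier_vec N" using L x by auto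
    ultimately have "\<forall>s\<in>S. (L *\<^sub>v x) $ s = 0"
      using sampling_mat_mult_vec_eq_0_iff[OF S Lx]
        assoc_mult_mat_vec[OF sampling_mat_carrier L x] by simp
    then have supp: "(L *\<^sub>v x) $ j = 0" if "j < N" "j \<notin> T" for j
      using that T by auto
    \<comment> \<open>The synthesis coefficients are the values of \<open>L x\<close> on
      \<open>T\<close>. No information is lost, since \<open>L x\<close> vanishes elsewhere.\<close>
    define v where "v = sampling_mat N T *\<^sub>v (L *\<^sub>v x)"
    have v: "v \<in> carrier_vec (card T)"
      unfolding v_def by (rule mult_mat_vec_carrier[OF sampling_mat_carrier Lx])
    have Tv: "?T *\<^sub>v v = L *\<^sub>v x"
      unfolding v_def by (rule transpose_sampling_mat_sampling_mat[OF TN Lx supp])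
    \<comment> \<open>Zero-padding preserves sums, and \<open>L x\<close> has sum zero since the
      symmetric \<open>L\<close> can be moved onto the all-ones vector.\<close>
    have "v \<bullet> ones_vec (card T) = (L *\<^sub>v x) \<bullet> ones_vec N"
      using transpose_sampling_mat_scalar_ones[OF TN v] Tv by simp
    also have "\<dots> = x \<bullet> (L *\<^sub>v ones_vec N)"
      using transpose_vec_mult_scalar[OF L ones_vec_carrier x] sym by simp
    also have "\<dots> = 0" using L1 x by simp
    finally have "v \<in> mat_range (W_mat (card T))" using v mat_range_W_mat by auto
    \<comment> \<open>The mean of \<open>x\<close> is what is lost when the pseudoinverse is applied
      to \<open>L x\<close>.\<close>
    moreover define z where "z = x \<bullet> ones_vec N / real N"
    have "(?P * ?T) *\<^sub>v v = (?P * L) *\<^sub>v x"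
      using assoc_mult_mat_vec[OF P(1) transpose_sampling_mat_carrier v] Tv
        assoc_mult_mat_vec[OF P(1) L x] by simp
    then have Qv: "(?P * ?T) *\<^sub>v v = x - z \<cdot>\<^sub>v ones_vec N"
      using one_minus_mean_mat_mult_vec[OF x] P(3) by (simp add: z_def)
    then have "x = z \<cdot>\<^sub>v ones_vec N + (?P * ?T) *\<^sub>v v"
      unfolding Qv using x by (intro eq_vecI) (auto simp: ones_vec_def)
    moreover have "z \<cdot>\<^sub>v ones_vec N \<in> mat_kernel L" unfolding ker by blast
    ultimately show "x \<in> {u + (?P * ?T) *\<^sub>v v
        | u v. u \<in> mat_kernel L \<and> v \<in> mat_range (W_mat (card T))}"
      by blast
  }
  fix x assume "x \<in> {u + (?P * ?T) *\<^sub>v v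
      | u v. u \<in> mat_kernel L \<and> v \<in> mat_range (W_mat (card T))}"
  then obtain u v where x: "x = u + (?P * ?T) *\<^sub>v v" and u: "u \<in> mat_kernel L"
    and "v \<in> mat_range (W_mat (card T))" by blast
  then have v: "v \<in> carrier_vec (card T)" and v0: "v \<bullet> ones_vec (card T) = 0"
    by (auto simp: mat_range_W_mat)
  define y where "y = ?T *\<^sub>v v"
  have y: "y \<in> carrier_vec N"
    unfolding y_def by (rule mult_mat_vec_carrier[OF transpose_sampling_mat_carrier v])
  have y0: "y \<bullet> ones_vec N = 0"
    using transpose_sampling_mat_scalar_ones[OF TN v] v0 by (simp add: y_def)
  have x': "x = u + ?P *\<^sub>v y"
    using x assoc_mult_mat_vec[OF P(1) transpose_sampling_mat_carrier v] by (simp add: y_def)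
  have Py: "?P *\<^sub>v y \<in> carrier_vec N" using P(1) y by (rule mult_mat_vec_carrier)
  have u': "u \<in> carrier_vec N" "L *\<^sub>v u = 0\<^sub>v N" using mat_kernelD[OF L u] by auto
  have xc: "x \<in> carrier_vec N" using x' u' Py by auto
  \<comment> \<open>The summand \<open>u\<close> is killed by \<open>L\<close>, and centring does
    not change \<open>y\<close>, which has sum zero. So \<open>L x\<close> is \<open>y\<close>, and
    \<open>y\<close> is supported on \<open>T\<close>.\<close>
  have "L *\<^sub>v x = L *\<^sub>v (?P *\<^sub>v y)"
    unfolding x' using mult_add_distrib_mat_vec[OF L u'(1) Py] u'(2) L Py by auto
  also have "\<dots> = (1\<^sub>m N - mean_mat N) *\<^sub>v y"
    using assoc_mult_mat_vec[OF L P(1) y] P(2) by simp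
  also have "\<dots> = y"
    unfolding one_minus_mean_mat_mult_vec[OF y] y0 using y
    by (intro eq_vecI) (auto simp: ones_vec_def)
  finally have Lx: "L *\<^sub>v x = y" .
  have "\<forall>s\<in>S. y $ s = 0"
    using transpose_sampling_mat_mult_vec_notin[OF TN v] S T by (auto simp: y_def)
  then have "(sampling_mat N S * L) *\<^sub>v x = 0\<^sub>v (card S)"
    using sampling_mat_mult_vec_eq_0_iff[OF S y] Lx
      assoc_mult_mat_vec[OF sampling_mat_carrier L xc] by simp
  then show "x \<in> mat_kernel (sampling_mat N S * L)"
    by (intro mat_kernelI[OF SL xc])
qed

theorem theorem3p1:
  fixes N n :: nat and G :: "nat pair_pre_digraph" and A L :: "real mat" and \<Lambda> \<Lambda>c :: "nat set"
  assumes "pair_pseudo_graph G"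
    and "Digraph_Component.connected (with_proj G)"
    and "pverts G = {0..<N}"
    and "weighted_adjacency N G A"
    and "L = graph_laplacian A"
    and "\<Lambda> \<subseteq> pverts G"
    and "card \<Lambda> < N"
    and "\<Lambda>c = pverts G - \<Lambda>"
    and "n = card \<Lambda>c"
  shows "mat_kernel (sampling_mat N \<Lambda> * L) =
      {z \<cdot>\<^sub>v ones_vec N + (pseudoinverse L * transpose_mat (sampling_mat N \<Lambda>c) * W_mat n) *\<^sub>v c
        | z c. c \<in> carrier_vec (n - 1)}
    \<and> mat_kernel (sampling_mat N \<Lambda> * L) =
      {u + (pseudoinverse L * transpose_mat (sampling_mat N \<Lambda>c)) *\<^sub>v v
        | u v. u \<in> mat_kernel L \<and> v \<in> mat_range (W_mat n)}
    \<and> {(pseudoinverse L * transpose_mat (sampling_mat N \<Lambda>c)) *\<^sub>v v | v. v \<in> mat_range (W_mat n)}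
      \<subseteq> {(pseudoinverse L * transpose_mat (sampling_mat N \<Lambda>c)) *\<^sub>v v | v. v \<in> carrier_vec n}
    \<and> mat_kernel L = {z \<cdot>\<^sub>v ones_vec N | z. True}
    \<and> (\<forall>j<n - 1.
        ((transpose_mat (sampling_mat N \<Lambda>c) * W_mat n) *\<^sub>v unit_vec (n - 1) j) \<bullet> ones_vec N = 0)"
proof -
  have L: "L \<in> carrier_mat N N" and sym: "transpose_mat L = L"
    and ker: "mat_kernel L = {z \<cdot>\<^sub>v ones_vec N | z. True}"
    using graph_laplacian_carrier[OF assms(4)] transpose_graph_laplacian[OF assms(4)]
      mat_kernel_graph_laplacian[OF assms(1-4)] assms(5) by auto
  have N: "N > 0" using assms(7) by simp
  have S: "\<Lambda> \<subseteq> {0..<N}" and T: "\<Lambda>c = {0..<N} - \<Lambda>" using assms(3,6,8) by auto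
  have n: "n = card \<Lambda>c" by fact
  have TN: "\<Lambda>c \<subseteq> {0..<N}" using T by auto
  let ?T = "transpose_mat (sampling_mat N \<Lambda>c)"
  let ?Q = "pseudoinverse L * ?T"
  have Tc: "?T \<in> carrier_mat N n" unfolding n by (rule transpose_sampling_mat_carrier)
  have Q: "?Q \<in> carrier_mat N n"
    using pseudoinverse_kernel_ones(1)[OF L sym ker N] Tc by (rule mult_carrier_mat)
  have W: "mat_range (W_mat n) = {W_mat n *\<^sub>v c | c. c \<in> carrier_vec (n - 1)}"
    by (simp add: mat_range_def W_mat_def)
  have QW: "(?Q * W_mat n) *\<^sub>v c = ?Q *\<^sub>v (W_mat n *\<^sub>v c)" if "c \<in> carrier_vec (n - 1)" for c
    using assoc_mult_mat_vec[OF Q W_mat_carrier that] .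
  have 2: "mat_kernel (sampling_mat N \<Lambda> * L) =
      {u + ?Q *\<^sub>v v | u v. u \<in> mat_kernel L \<and> v \<in> mat_range (W_mat n)}"
    using mat_kernel_sampling_laplacian[OF L sym ker N S T] n by simp
  also have "\<dots> = {z \<cdot>\<^sub>v ones_vec N + ?Q *\<^sub>v (W_mat n *\<^sub>v c) | z c. c \<in> carrier_vec (n - 1)}"
    unfolding ker W by blast
  \<comment> \<open>Reassociation needs the dimension of \<open>c\<close>, which the membership
    condition of the set supplies.\<close>
  also have "\<dots> = {z \<cdot>\<^sub>v ones_vec N + (?Q * W_mat n) *\<^sub>v c | z c. c \<in> carrier_vec (n - 1)}"
    by (rule Collect_cong) (metis QW)
  finally have 1: "mat_kernel (sampling_mat N \<Lambda> * L) =
      {z \<cdot>\<^sub>v ones_vec N + (?Q * W_mat n) *\<^sub>v c | z c. c \<in> carrier_vec (n - 1)}" .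
  have 3: "{?Q *\<^sub>v v | v. v \<in> mat_range (W_mat n)} \<subseteq> {?Q *\<^sub>v v | v. v \<in> carrier_vec n}"
    unfolding mat_range_W_mat by blast
  \<comment> \<open>For \<open>j < n - 1\<close> the vector \<open>?w\<close> is column
    \<open>j\<close> of \<open>W\<close>. It has sum zero, and zero-padding by \<open>?T\<close>
    keeps that sum.\<close>
  have 4: "((?T * W_mat n) *\<^sub>v unit_vec (n - 1) j) \<bullet> ones_vec N = 0" for j
  proof -
    let ?w = "W_mat n *\<^sub>v unit_vec (n - 1) j"
    have "?w \<in> carrier_vec (card \<Lambda>c)"
      unfolding n by (rule mult_mat_vec_carrier[OF W_mat_carrier]) simp
    then have "(?T *\<^sub>v ?w) \<bullet> ones_vec N = ?w \<bullet> ones_vec n"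
      using transpose_sampling_mat_scalar_ones[OF TN] n by simp
    also have "\<dots> = 0" by (rule W_mat_scalar_ones) simp
    finally show ?thesis
      unfolding assoc_mult_mat_vec[OF Tc W_mat_carrier unit_vec_carrier] .
  qed
  show ?thesis using 1 2 3 ker 4 by (intro conjI allI impI)
qed

end
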